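(* Let $0\longrightarrow B\stackrel{i}{\longrightarrow}E\stackrel{p}{\longrightarrow}A\longrightarrow0$ be a non-abelian extension of an anti-dendriform algebra $(A,\succ_A,\prec_A)$ by an anti-dendriform algebra $(B,\succ_B,\prec_B)$ with a section $s$ of $p$, and let $(l_{\succ},r_{\succ},l_{\prec},r_{\prec},\omega_1,\omega_2)$ be the corresponding non-abelian 2-cocycle induced by $s$. A pair $(\alpha,\beta)\in\mathrm{Aut}(A)\times\mathrm{Aut}(B)$ is inducible if and only if there is a linear map $\varphi:A\to B$ such that for all $x,y\in A$ and $a\in B$: $$\beta(l_{\succ}(x)a)-l_{\succ}(\alpha(x))\beta(a)=\varphi(x)\succ_B\beta(a),\quad \beta(r_{\succ}(x)a)-r_{\succ}(\alpha(x))\beta(a)=\beta(a)\succ_B\varphi(x),$$ $$\beta(l_{\prec}(x)a)-l_{\prec}(\alpha(x))\beta(a)=\varphi(x)\prec_B\beta(a),\quad \beta(r_{\prec}(x)a)-r_{\prec}(\alpha(x))\beta(a)=\beta(a)\prec_B\varphi(x),$$ $$\beta\omega_1(x,y)-\omega_1(\alpha(x),\alpha(y))=\varphi(x)\succ_B\varphi(y)-\varphi(x\succ_A y)+l_{\succ}(\alpha(x))\varphi(y)+r_{\succ}(\alpha(y))\varphi(x),$$ $$\beta\omega_2(x,y)-\omega_2(\alpha(x),\alpha(y))=\varphi(x)\prec_B\varphi(y)-\varphi(x\prec_A y)+l_{\prec}(\alpha(x))\varphi(y)+r_{\prec}(\alpha(y))\varphi(x).$$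
   Context: All vector spaces and algebras are over a field $k$, and all algebras are finite-dimensional. An anti-dendriform algebra $(A,\succ,\prec)$ is a vector space with two bilinear maps $\succ,\prec:A\times A\to A$ such that, writing $x\cdot y=x\succ y+x\prec y$, for all $x,y,z$: $x\succ(y\succ z)=-(x\cdot y)\succ z=-x\prec(y\cdot z)=(x\prec y)\prec z$ and $(x\succ y)\prec z=x\succ(y\prec z)$. Homomorphisms preserve both operations; $\mathrm{Aut}$ denotes the group of automorphisms. A non-abelian extension of $A$ by $B$ is an anti-dendriform algebra $(E,\succ_E,\prec_E)$ with a short exact sequence $0\to B\stackrel{i}{\to}E\stackrel{p}{\to}A\to0$ of anti-dendriform algebras; $B$ is identified with $i(B)\subseteq E$. A section of $p$ is a linear map $s:A\to E$ with $ps=\mathrm{id}_A$. The non-abelian 2-cocycle induced by $s$ is given by the linear maps $l_{\succ},r_{\succ},l_{\prec},r_{\prec}:A\to\mathrm{End}(B)$ and bilinear maps $\omega_1,\omega_2:A\times A\to B$ defined by $l_{\succ}(x)a=s(x)\succ_E a$, $r_{\succ}(x)a=a\succ_E s(x)$, $l_{\prec}(x)a=s(x)\prec_E a$, $r_{\prec}(x)a=a\prec_E s(x)$, $\omega_1(x,y)=s(x)\succ_E s(y)-s(x\succ_A y)$, $\omega_2(x,y)=s(x)\prec_E s(y)-s(x\prec_A y)$. A pair $(\alpha,\beta)\in\mathrm{Aut}(A)\times\mathrm{Aut}(B)$ is inducible (with respect to the extension) if there is $\gamma\in\mathrm{Aut}_B(E)=\{\gamma\in\mathrm{Aut}(E)\mid\gamma(B)=B\}$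 with $i\beta=\gamma i$ and $p\gamma=\alpha p$. *)

theory Defs
  imports Complex_Main
begin

text \<open>
  The underlying vector space of an algebra is a whole type \<open>'v\<close>, with scalar multiplication
  by an arbitrary field \<open>'k\<close> given as a record field.
\<close>

record ('k, 'v) ad_algebra =
  scal :: "'k \<Rightarrow> 'v \<Rightarrow> 'v"
  succ :: "'v \<Rightarrow> 'v \<Rightarrow> 'v"  (infixl \<open>\<succ>\<index>\<close> 70)
  prec :: "'v \<Rightarrow> 'v \<Rightarrow> 'v"  (infixl \<open>\<prec>\<index>\<close> 70)

definition bilinear_op :: "('k::field \<Rightarrow> 'v::ab_group_add \<Rightarrow> 'v) \<Rightarrow> ('v \<Rightarrow> 'v \<Rightarrow> 'v) \<Rightarrow> bool" where
  "bilinear_op sc f \<longleftrightarrow>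
     (\<forall>x. Vector_Spaces.linear sc sc (\<lambda>y. f x y)) \<and>
     (\<forall>y. Vector_Spaces.linear sc sc (\<lambda>x. f x y))"

locale anti_dendriform =
  fixes A :: "('k::field, 'v::ab_group_add) ad_algebra" (structure)
  assumes finite_dim: "\<exists>Basis. finite_dimensional_vector_space (scal A) Basis"
    and bilinear_succ: "bilinear_op (scal A) (succ A)"
    and bilinear_prec: "bilinear_op (scal A) (prec A)"
    and ad1: "x \<succ> (y \<succ> z) = - ((x \<succ> y + x \<prec> y) \<succ> z)"
    and ad2: "x \<succ> (y \<succ> z) = - (x \<prec> (y \<succ> z + y \<prec> z))"
    and ad3: "x \<succ> (y \<succ> z) = (x \<prec> y) \<prec> z"
    and ad4: "(x \<succ> y) \<prec> z = x \<succ> (y \<prec> z)"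

definition ad_hom ::
  "('k::field, 'v::ab_group_add) ad_algebra \<Rightarrow> ('k, 'w::ab_group_add) ad_algebra \<Rightarrow> ('v \<Rightarrow> 'w) \<Rightarrow> bool" where
  "ad_hom A B f \<longleftrightarrow>
     Vector_Spaces.linear (scal A) (scal B) f \<and>
     (\<forall>x y. f (x \<succ>\<^bsub>A\<^esub> y) = f x \<succ>\<^bsub>B\<^esub> f y) \<and>
     (\<forall>x y. f (x \<prec>\<^bsub>A\<^esub> y) = f x \<prec>\<^bsub>B\<^esub> f y)"

definition Aut :: "('k::field, 'v::ab_group_add) ad_algebra \<Rightarrow> ('v \<Rightarrow> 'v) set" where
  "Aut A = {f. ad_hom A A f \<and> bij f}"

locale nonabelian_extension =
  A: anti_dendriform A + B: anti_dendriform B + E: anti_dendriform E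
  for A :: "('k::field, 'a::ab_group_add) ad_algebra"
    and B :: "('k, 'b::ab_group_add) ad_algebra"
    and E :: "('k, 'e::ab_group_add) ad_algebra" +
  fixes i :: "'b \<Rightarrow> 'e" and p :: "'e \<Rightarrow> 'a"
  assumes hom_i: "ad_hom B E i"
    and hom_p: "ad_hom E A p"
    and inj_i: "inj i"
    and exact: "range i = {e. p e = 0}"
    and surj_p: "surj p"

definition is_section ::
  "('k::field, 'a::ab_group_add) ad_algebra \<Rightarrow> ('k, 'e::ab_group_add) ad_algebra \<Rightarrow>
    ('e \<Rightarrow> 'a) \<Rightarrow> ('a \<Rightarrow> 'e) \<Rightarrow> bool" where
  "is_section A E p s \<longleftrightarrow> Vector_Spaces.linear (scal A) (scal E) s \<and> p \<circ> s = id"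

text \<open>
  \<open>B\<close> is not literally a subset of \<open>E\<close>: the elements \<open>s(x) \<succ> i(a)\<close> etc. of \<open>i(B)\<close> are pulled
  back to \<open>B\<close> along the injection \<open>i\<close>. The argument \<open>f\<close> (and \<open>g\<close>) is one of the two operations of
  \<open>E\<close> (and the same operation of \<open>A\<close>).
\<close>

definition left_action :: "('b \<Rightarrow> 'e) \<Rightarrow> ('e \<Rightarrow> 'e \<Rightarrow> 'e) \<Rightarrow> ('a \<Rightarrow> 'e) \<Rightarrow> 'a \<Rightarrow> 'b \<Rightarrow> 'b" where
  "left_action i f s x a = inv i (f (s x) (i a))"

definition right_action :: "('b \<Rightarrow> 'e) \<Rightarrow> ('e \<Rightarrow> 'e \<Rightarrow> 'e) \<Rightarrow> ('a \<Rightarrow> 'e) \<Rightarrow> 'a \<Rightarrow> 'b \<Rightarrow> 'b" where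
  "right_action i f s x a = inv i (f (i a) (s x))"

definition defect ::
  "('b \<Rightarrow> 'e::ab_group_add) \<Rightarrow> ('a \<Rightarrow> 'a \<Rightarrow> 'a) \<Rightarrow> ('e \<Rightarrow> 'e \<Rightarrow> 'e) \<Rightarrow> ('a \<Rightarrow> 'e) \<Rightarrow> 'a \<Rightarrow> 'a \<Rightarrow> 'b" where
  "defect i g f s x y = inv i (f (s x) (s y) - s (g x y))"

text \<open>The order of the components is \<open>(l\<^sub>\<succ>, r\<^sub>\<succ>, l\<^sub>\<prec>, r\<^sub>\<prec>, \<omega>\<^sub>1, \<omega>\<^sub>2)\<close>.\<close>

definition induced_cocycle ::
  "('k::field, 'a::ab_group_add) ad_algebra \<Rightarrow> ('k, 'e::ab_group_add) ad_algebra \<Rightarrow>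
    ('b \<Rightarrow> 'e) \<Rightarrow> ('a \<Rightarrow> 'e) \<Rightarrow>
    ('a \<Rightarrow> 'b \<Rightarrow> 'b) \<times> ('a \<Rightarrow> 'b \<Rightarrow> 'b) \<times> ('a \<Rightarrow> 'b \<Rightarrow> 'b) \<times> ('a \<Rightarrow> 'b \<Rightarrow> 'b) \<times>
    ('a \<Rightarrow> 'a \<Rightarrow> 'b) \<times> ('a \<Rightarrow> 'a \<Rightarrow> 'b)" where
  "induced_cocycle A E i s =
     (left_action i (succ E) s, right_action i (succ E) s,
      left_action i (prec E) s, right_action i (prec E) s,
      defect i (succ A) (succ E) s, defect i (prec A) (prec E) s)"

definition Aut_sub :: "('k::field, 'e::ab_group_add) ad_algebra \<Rightarrow> 'e set \<Rightarrow> ('e \<Rightarrow> 'e) set" where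
  "Aut_sub E S = {\<gamma> \<in> Aut E. \<gamma> ` S = S}"

definition inducible ::
  "('k::field, 'e::ab_group_add) ad_algebra \<Rightarrow> ('b \<Rightarrow> 'e) \<Rightarrow> ('e \<Rightarrow> 'a) \<Rightarrow>
    ('a \<Rightarrow> 'a) \<Rightarrow> ('b \<Rightarrow> 'b) \<Rightarrow> bool" where
  "inducible E i p \<alpha> \<beta> \<longleftrightarrow>
     (\<exists>\<gamma> \<in> Aut_sub E (range i). i \<circ> \<beta> = \<gamma> \<circ> i \<and> p \<circ> \<gamma> = \<alpha> \<circ> p)"

context nonabelian_extension
begin

lemma i_inv_i: "p e = 0 \<Longrightarrow> i (inv i e) = e"
  using exact by (auto intro: f_inv_into_f)

lemma p_i: "p (i a) = 0"
  using exact by auto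

lemma p_linear: "Vector_Spaces.linear (scal E) (scal A) p"
  using hom_p by (simp add: ad_hom_def)

lemma A_mult_zero:
  "x \<succ>\<^bsub>A\<^esub> 0 = 0" "0 \<succ>\<^bsub>A\<^esub> x = 0" "x \<prec>\<^bsub>A\<^esub> 0 = 0" "0 \<prec>\<^bsub>A\<^esub> x = 0"
  using A.bilinear_succ A.bilinear_prec
  by (auto simp: bilinear_op_def dest!: spec[where x = x] dest: Vector_Spaces.linear.axioms(3) module_hom.zero)

text \<open>The induced maps are the intended ones: all arguments of \<open>inv i\<close> lie in \<open>i(B)\<close>.\<close>

lemma i_induced_cocycle:
  assumes s: "is_section A E p s"
  shows "i (left_action i (succ E) s x a) = s x \<succ>\<^bsub>E\<^esub> i a"
    and "i (right_action i (succ E) s x a) = i a \<succ>\<^bsub>E\<^esub> s x"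
    and "i (left_action i (prec E) s x a) = s x \<prec>\<^bsub>E\<^esub> i a"
    and "i (right_action i (prec E) s x a) = i a \<prec>\<^bsub>E\<^esub> s x"
    and "i (defect i (succ A) (succ E) s x y) = s x \<succ>\<^bsub>E\<^esub> s y - s (x \<succ>\<^bsub>A\<^esub> y)"
    and "i (defect i (prec A) (prec E) s x y) = s x \<prec>\<^bsub>E\<^esub> s y - s (x \<prec>\<^bsub>A\<^esub> y)"
proof -
  have ps: "p (s x) = x" for x
    using s by (simp add: is_section_def fun_eq_iff)
  have diff: "p (u - v) = p u - p v" for u v
    using p_linear unfolding Vector_Spaces.linear_def by (blast dest: module_hom.diff)
  note h = hom_p[unfolded ad_hom_def]
  show "i (left_action i (succ E) s x a) = s x \<succ>\<^bsub>E\<^esub> i a"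
    "i (right_action i (succ E) s x a) = i a \<succ>\<^bsub>E\<^esub> s x"
    "i (left_action i (prec E) s x a) = s x \<prec>\<^bsub>E\<^esub> i a"
    "i (right_action i (prec E) s x a) = i a \<prec>\<^bsub>E\<^esub> s x"
    "i (defect i (succ A) (succ E) s x y) = s x \<succ>\<^bsub>E\<^esub> s y - s (x \<succ>\<^bsub>A\<^esub> y)"
    "i (defect i (prec A) (prec E) s x y) = s x \<prec>\<^bsub>E\<^esub> s y - s (x \<prec>\<^bsub>A\<^esub> y)"
    unfolding left_action_def right_action_def defect_def
    by (rule i_inv_i, simp add: h ps p_i A_mult_zero diff)+
qed

end

end

theory Submission
  imports Defs
begin

text \<open>
  Since \<open>E = s(A) \<oplus> i(B)\<close>, a linear map \<open>\<gamma>\<close> on \<open>E\<close> with \<open>\<gamma> \<circ> i = i \<circ> \<beta>\<close> and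
  \<open>p \<circ> \<gamma> = \<alpha> \<circ> p\<close> is determined by its values \<open>\<gamma> (s x)\<close>. These lie over \<open>\<alpha> x\<close>, so they have
  the form \<open>\<gamma> (s x) = s (\<alpha> x) + i (\<phi> x)\<close> for a linear \<open>\<phi> : A \<rightarrow> B\<close>, and every linear \<open>\<phi>\<close>
  arises from exactly one \<open>\<gamma>\<close> in this way (\<open>difference_of_lift\<close>, \<open>lift_of_difference\<close>).
  Such a \<open>\<gamma>\<close> is automatically bijective, by the short five lemma, and maps \<open>i(B)\<close> onto itself.
  Inducibility therefore asks only for a \<open>\<phi>\<close> whose \<open>\<gamma>\<close> preserves both operations
  (\<open>inducible_iff_hom\<close>).

  For each operation \<open>\<star>\<close>, the failure \<open>\<gamma> (e \<star> f) - \<gamma> e \<star> \<gamma> f\<close> is additive in \<open>e\<close> and in \<open>f\<close>,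
  so it vanishes identically as soon as it vanishes when \<open>e\<close> and \<open>f\<close> range over \<open>s(A)\<close> and
  \<open>i(B)\<close>. On \<open>i(B) \<times> i(B)\<close> it vanishes because \<open>\<beta>\<close> is a homomorphism. On \<open>s(A) \<times> i(B)\<close>,
  \<open>i(B) \<times> s(A)\<close> and \<open>s(A) \<times> s(A)\<close>, expanding the products in terms of the cocycle
  turns its vanishing into the equation for \<open>l\<close>, for \<open>r\<close> and for \<open>\<omega>\<close>
  (\<open>preserves_operation_iff\<close>).
\<close>

section \<open>Preservation of one operation\<close>

definition biadditive :: "('u::ab_group_add \<Rightarrow> 'v::ab_group_add \<Rightarrow> 'w::ab_group_add) \<Rightarrow> bool" where
  "biadditive g \<longleftrightarrow> (\<forall>x. additive (g x)) \<and> (\<forall>y. additive (\<lambda>x. g x y))"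

lemma linear_imp_additive: "Vector_Spaces.linear sc sc' f \<Longrightarrow> additive f"
  unfolding Vector_Spaces.linear_def additive_def by (blast dest: module_hom.add)

lemma bilinear_op_imp_biadditive: "bilinear_op sc g \<Longrightarrow> biadditive g"
  by (auto simp: bilinear_op_def biadditive_def intro: linear_imp_additive)

text \<open>
  This is where the cocycle equations come from. The operation \<open>gE\<close> is arbitrary, so that the
  lemma serves both \<open>\<succ>\<close> and \<open>\<prec>\<close>. The three clauses express that \<open>\<gamma>\<close> preserves products on
  \<open>s(A) \<times> i(B)\<close>, \<open>i(B) \<times> s(A)\<close> and \<open>s(A) \<times> s(A)\<close>: the two sides have the same component in
  \<open>s(A)\<close> because \<open>\<alpha>\<close> is a homomorphism, and their components in \<open>i(B)\<close> are compared in \<open>B\<close>.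
\<close>

lemma preserves_operation_iff:
  fixes i :: "'b::ab_group_add \<Rightarrow> 'e::ab_group_add" and s :: "'a::ab_group_add \<Rightarrow> 'e"
  assumes i: "additive i" "inj i" and gE: "biadditive gE" and \<gamma>: "additive \<gamma>"
    and split: "\<And>e. \<exists>x a. e = s x + i a"
    and iB: "\<And>a b. i (gB a b) = gE (i a) (i b)"
    and L: "\<And>x a. i (L x a) = gE (s x) (i a)"
    and R: "\<And>x a. i (R x a) = gE (i a) (s x)"
    and W: "\<And>x y. i (W x y) = gE (s x) (s y) - s (gA x y)"
    and \<alpha>: "\<And>x y. \<alpha> (gA x y) = gA (\<alpha> x) (\<alpha> y)"
    and \<beta>: "\<And>a b. \<beta> (gB a b) = gB (\<beta> a) (\<beta> b)"
    and \<gamma>i: "\<And>a. \<gamma> (i a) = i (\<beta> a)"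
    and \<gamma>s: "\<And>x. \<gamma> (s x) = s (\<alpha> x) + i (\<phi> x)"
  shows "(\<forall>e f. \<gamma> (gE e f) = gE (\<gamma> e) (\<gamma> f)) \<longleftrightarrow>
    (\<forall>x a. \<beta> (L x a) - L (\<alpha> x) (\<beta> a) = gB (\<phi> x) (\<beta> a)) \<and>
    (\<forall>x a. \<beta> (R x a) - R (\<alpha> x) (\<beta> a) = gB (\<beta> a) (\<phi> x)) \<and>
    (\<forall>x y. \<beta> (W x y) - W (\<alpha> x) (\<alpha> y) =
      gB (\<phi> x) (\<phi> y) - \<phi> (gA x y) + L (\<alpha> x) (\<phi> y) + R (\<alpha> y) (\<phi> x))"
proof -
  note i_add = additive.add[OF i(1)] additive.diff[OF i(1)]
  have gE_add: "gE (u + v) w = gE u w + gE v w" "gE w (u + v) = gE w u + gE w v" for u v w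
    using gE by (simp_all add: biadditive_def additive_def)
  have i_eq: "a = b \<longleftrightarrow> i a = i b" for a b
    using i(2) by (simp add: inj_eq)
  have s_i: "\<gamma> (gE (s x) (i a)) = gE (\<gamma> (s x)) (\<gamma> (i a)) \<longleftrightarrow>
      \<beta> (L x a) - L (\<alpha> x) (\<beta> a) = gB (\<phi> x) (\<beta> a)" for x a
  proof -
    have "\<gamma> (gE (s x) (i a)) = i (\<beta> (L x a))"
      by (simp flip: L \<gamma>i)
    moreover have "gE (\<gamma> (s x)) (\<gamma> (i a)) = i (L (\<alpha> x) (\<beta> a) + gB (\<phi> x) (\<beta> a))"
      by (simp add: \<gamma>i \<gamma>s gE_add i_add L iB)
    ultimately show ?thesis
      by (simp add: i_eq[symmetric] algebra_simps)
  qed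
  have i_s: "\<gamma> (gE (i a) (s x)) = gE (\<gamma> (i a)) (\<gamma> (s x)) \<longleftrightarrow>
      \<beta> (R x a) - R (\<alpha> x) (\<beta> a) = gB (\<beta> a) (\<phi> x)" for x a
  proof -
    have "\<gamma> (gE (i a) (s x)) = i (\<beta> (R x a))"
      by (simp flip: R \<gamma>i)
    moreover have "gE (\<gamma> (i a)) (\<gamma> (s x)) = i (R (\<alpha> x) (\<beta> a) + gB (\<beta> a) (\<phi> x))"
      by (simp add: \<gamma>i \<gamma>s gE_add i_add R iB)
    ultimately show ?thesis
      by (simp add: i_eq[symmetric] algebra_simps)
  qed
  have s_s: "\<gamma> (gE (s x) (s y)) = gE (\<gamma> (s x)) (\<gamma> (s y)) \<longleftrightarrow>
      \<beta> (W x y) - W (\<alpha> x) (\<alpha> y) =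
      gB (\<phi> x) (\<phi> y) - \<phi> (gA x y) + L (\<alpha> x) (\<phi> y) + R (\<alpha> y) (\<phi> x)" for x y
  proof -
    have prod: "gE (s u) (s v) = s (gA u v) + i (W u v)" for u v
      by (simp add: W)
    have "\<gamma> (gE (s x) (s y)) =
        s (gA (\<alpha> x) (\<alpha> y)) + i (\<phi> (gA x y) + \<beta> (W x y))"
      by (simp add: prod additive.add[OF \<gamma>] \<gamma>i \<gamma>s i_add \<alpha> add.assoc)
    moreover have "gE (\<gamma> (s x)) (\<gamma> (s y)) = s (gA (\<alpha> x) (\<alpha> y)) +
        i (W (\<alpha> x) (\<alpha> y) + L (\<alpha> x) (\<phi> y) + R (\<alpha> y) (\<phi> x) + gB (\<phi> x) (\<phi> y))"
      by (simp add: \<gamma>s gE_add i_add prod L R iB add_ac)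
    ultimately show ?thesis
      by (auto simp: i_eq[symmetric] algebra_simps)
  qed
  have i_i: "\<gamma> (gE (i a) (i b)) = gE (\<gamma> (i a)) (\<gamma> (i b))" for a b
    by (simp add: \<gamma>i \<beta> flip: iB)
  have "(\<forall>e f. \<gamma> (gE e f) = gE (\<gamma> e) (\<gamma> f)) \<longleftrightarrow>
      (\<forall>x a. \<gamma> (gE (s x) (i a)) = gE (\<gamma> (s x)) (\<gamma> (i a))) \<and>
      (\<forall>x a. \<gamma> (gE (i a) (s x)) = gE (\<gamma> (i a)) (\<gamma> (s x))) \<and>
      (\<forall>x y. \<gamma> (gE (s x) (s y)) = gE (\<gamma> (s x)) (\<gamma> (s y)))" (is "?hom \<longleftrightarrow> ?gens")
  proof
    assume gens: ?gens
    show ?hom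
    proof (intro allI)
      fix e f
      obtain x a y b where "e = s x + i a" "f = s y + i b"
        using split by meson
      then show "\<gamma> (gE e f) = gE (\<gamma> e) (\<gamma> f)"
        using gens i_i by (simp add: gE_add additive.add[OF \<gamma>])
    qed
  qed blast
  then show ?thesis
    unfolding s_i i_s s_s .
qed

section \<open>Lifts of a pair of automorphisms\<close>

context nonabelian_extension
begin

text \<open>
  Bijectivity of \<open>\<gamma>\<close> is the short five lemma, and \<open>\<gamma>\<close> maps \<open>i(B)\<close> onto itself because
  \<open>\<beta>\<close> is surjective.
\<close>

lemma inducible_iff_hom:
  assumes \<alpha>: "\<alpha> \<in> Aut A" and \<beta>: "\<beta> \<in> Aut B"
  shows "inducible E i p \<alpha> \<beta> \<longleftrightarrow>
    (\<exists>\<gamma>. ad_hom E E \<gamma> \<and> (\<forall>a. \<gamma> (i a) = i (\<beta> a)) \<and> (\<forall>e. p (\<gamma> e) = \<alpha> (p e)))"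
proof
  assume "inducible E i p \<alpha> \<beta>"
  then show "\<exists>\<gamma>. ad_hom E E \<gamma> \<and> (\<forall>a. \<gamma> (i a) = i (\<beta> a)) \<and> (\<forall>e. p (\<gamma> e) = \<alpha> (p e))"
    unfolding inducible_def Aut_sub_def Aut_def by (force simp: fun_eq_iff)
next
  assume "\<exists>\<gamma>. ad_hom E E \<gamma> \<and> (\<forall>a. \<gamma> (i a) = i (\<beta> a)) \<and> (\<forall>e. p (\<gamma> e) = \<alpha> (p e))"
  then obtain \<gamma> where hom: "ad_hom E E \<gamma>" and \<gamma>i: "\<And>a. \<gamma> (i a) = i (\<beta> a)"
    and p\<gamma>: "\<And>e. p (\<gamma> e) = \<alpha> (p e)"
    by blast
  have add: "additive \<gamma>" "additive i" "additive p" "additive \<alpha>" "additive \<beta>"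
    using hom hom_i hom_p \<alpha> \<beta> by (auto simp: ad_hom_def Aut_def intro: linear_imp_additive)
  note zero = add[THEN additive.zero]
  have bij: "bij \<alpha>" "bij \<beta>"
    using \<alpha> \<beta> by (auto simp: Aut_def)
  have "e = 0" if "\<gamma> e = 0" for e
  proof -
    have "\<alpha> (p e) = \<alpha> 0"
      using p\<gamma>[of e] that by (simp add: zero)
    then have "p e = 0"
      using bij(1) by (simp add: bij_def inj_eq)
    then obtain a where e: "e = i a"
      using exact by blast
    then have "i (\<beta> a) = i (\<beta> 0)"
      using that \<gamma>i by (simp add: zero)
    then have "a = 0"
      using inj_i bij(2) by (simp add: bij_def inj_eq)
    then show ?thesis
      using e by (simp add: zero)
  qed
  then have "inj \<gamma>"
    by (metis injI additive.diff[OF add(1)] eq_iff_diff_eq_0)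
  moreover have "surj \<gamma>"
  proof (unfold surj_def, intro allI)
    fix f
    obtain x where x: "\<alpha> x = p f"
      using bij(1) by (metis bij_pointE)
    obtain e where e: "p e = x"
      using surj_p by (metis surjD)
    have "p (f - \<gamma> e) = 0"
      using x e p\<gamma> by (simp add: additive.diff[OF add(3)])
    then obtain b where b: "f - \<gamma> e = i b"
      using exact by blast
    obtain a where "\<beta> a = b"
      using bij(2) by (metis bij_pointE)
    then have "f = \<gamma> (e + i a)"
      using b by (simp add: additive.add[OF add(1)] \<gamma>i algebra_simps)
    then show "\<exists>e. f = \<gamma> e" ..
  qed
  moreover have "\<gamma> ` range i = range i"
  proof -
    have "\<gamma> ` range i = i ` range \<beta>"
      by (simp add: image_image \<gamma>i)
    then show ?thesis
      using bij(2) by (simp add: bij_def)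
  qed
  ultimately have "\<gamma> \<in> Aut_sub E (range i)"
    using hom by (simp add: Aut_sub_def Aut_def bij_def)
  then show "inducible E i p \<alpha> \<beta>"
    unfolding inducible_def using \<gamma>i p\<gamma> by (intro bexI[of _ \<gamma>]) (simp_all add: fun_eq_iff)
qed

lemma section_split:
  assumes "is_section A E p s"
  shows "i (inv i (e - s (p e))) = e - s (p e)"
proof (rule i_inv_i)
  have "p (s x) = x" for x
    using assms by (simp add: is_section_def fun_eq_iff)
  then show "p (e - s (p e)) = 0"
    by (simp add: additive.diff[OF linear_imp_additive[OF p_linear]])
qed

text \<open>
  A linear map with values in \<open>i(B)\<close> stays linear when it is read as a map to \<open>B\<close>. Both
  \<open>\<phi> = i\<^sup>-\<^sup>1 \<circ> (\<gamma> \<circ> s - s \<circ> \<alpha>)\<close> and the projection \<open>i\<^sup>-\<^sup>1 \<circ> (id - s \<circ> p)\<close> of \<open>E\<close> to \<open>B\<close> are of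
  this kind.
\<close>

lemma linear_pullback_i:
  assumes g: "Vector_Spaces.linear sc (scal E) g" and ig: "\<And>x. i (h x) = g x"
  shows "Vector_Spaces.linear sc (scal B) h"
proof -
  have il: "Vector_Spaces.linear (scal B) (scal E) i"
    using hom_i by (simp add: ad_hom_def)
  interpret i: Vector_Spaces.linear "scal B" "scal E" i by (rule il)
  interpret g: Vector_Spaces.linear sc "scal E" g by (rule g)
  have "h (x + y) = h x + h y" for x y
    by (rule injD[OF inj_i]) (simp add: ig i.add g.add)
  moreover have "h (sc c x) = scal B c (h x)" for c x
    by (rule injD[OF inj_i]) (simp add: ig i.scale g.scale)
  ultimately show ?thesis
    by unfold_locales
qed

lemma difference_of_lift:
  assumes s: "is_section A E p s"
    and \<alpha>: "Vector_Spaces.linear (scal A) (scal A) \<alpha>"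
    and \<gamma>: "Vector_Spaces.linear (scal E) (scal E) \<gamma>"
    and p\<gamma>: "\<And>e. p (\<gamma> e) = \<alpha> (p e)"
  shows "\<exists>\<phi>. Vector_Spaces.linear (scal A) (scal B) \<phi> \<and>
    (\<forall>x. \<gamma> (s x) = s (\<alpha> x) + i (\<phi> x))"
proof -
  have sl: "Vector_Spaces.linear (scal A) (scal E) s" and ps: "p (s x) = x" for x
    using s by (simp_all add: is_section_def fun_eq_iff)
  interpret EE: vector_space_pair "scal A" "scal E"
    using sl by (auto simp: vector_space_pair_def Vector_Spaces.linear_def)
  have g: "Vector_Spaces.linear (scal A) (scal E) (\<lambda>x. \<gamma> (s x) - s (\<alpha> x))"
    using EE.linear_compose_sub[OF Vector_Spaces.linear_compose[OF sl \<gamma>] Vector_Spaces.linear_compose[OF \<alpha> sl]]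
    by (simp add: o_def)
  define \<phi> where "\<phi> x = inv i (\<gamma> (s x) - s (\<alpha> x))" for x
  have \<phi>: "i (\<phi> x) = \<gamma> (s x) - s (\<alpha> x)" for x
    using section_split[OF s, of "\<gamma> (s x)"] by (simp add: \<phi>_def p\<gamma> ps)
  show ?thesis
    using linear_pullback_i[OF g \<phi>] \<phi> by (intro exI[of _ \<phi>]) simp
qed

text \<open>
  The lift is \<open>\<gamma> (s x + i a) = s (\<alpha> x) + i (\<phi> x + \<beta> a)\<close>, with the coordinates of \<open>e\<close> given by
  \<open>x = p e\<close> and \<open>a = i\<^sup>-\<^sup>1 (e - s (p e))\<close>.
\<close>

lemma lift_of_difference:
  assumes s: "is_section A E p s"
    and \<alpha>: "Vector_Spaces.linear (scal A) (scal A) \<alpha>"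
    and \<beta>: "Vector_Spaces.linear (scal B) (scal B) \<beta>"
    and \<phi>: "Vector_Spaces.linear (scal A) (scal B) \<phi>"
  shows "\<exists>\<gamma>. Vector_Spaces.linear (scal E) (scal E) \<gamma> \<and> (\<forall>a. \<gamma> (i a) = i (\<beta> a)) \<and>
    (\<forall>e. p (\<gamma> e) = \<alpha> (p e)) \<and> (\<forall>x. \<gamma> (s x) = s (\<alpha> x) + i (\<phi> x))"
proof -
  have sl: "Vector_Spaces.linear (scal A) (scal E) s" and ps: "p (s x) = x" for x
    using s by (simp_all add: is_section_def fun_eq_iff)
  have il: "Vector_Spaces.linear (scal B) (scal E) i"
    using hom_i by (simp add: ad_hom_def)
  interpret EE: vector_space_pair "scal E" "scal E"
    using sl by (auto simp: vector_space_pair_def Vector_Spaces.linear_def)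
  interpret EB: vector_space_pair "scal E" "scal B"
    using il by (auto simp: vector_space_pair_def Vector_Spaces.linear_def)
  note zero = additive.zero[OF linear_imp_additive]
  define r where "r e = inv i (e - s (p e))" for e
  have r: "i (r e) = e - s (p e)" for e
    unfolding r_def by (rule section_split[OF s])
  have "Vector_Spaces.linear (scal E) (scal E) (\<lambda>e. e - s (p e))"
    using EE.linear_compose_sub[OF EE.vs1.linear_id Vector_Spaces.linear_compose[OF p_linear sl]]
    by (simp add: o_def)
  then have rl: "Vector_Spaces.linear (scal E) (scal B) r"
    using r by (rule linear_pullback_i)
  have ri: "r (i a) = a" for a
    using r[of "i a"] inj_i by (simp add: p_i zero[OF sl] inj_eq)
  have rs: "r (s x) = 0" for x
    using r[of "s x"] inj_i by (simp add: ps injD[OF inj_i] zero[OF il])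
  define \<gamma> where "\<gamma> e = s (\<alpha> (p e)) + i (\<phi> (p e) + \<beta> (r e))" for e
  have "Vector_Spaces.linear (scal E) (scal E) \<gamma>"
    using EE.linear_compose_add[OF Vector_Spaces.linear_compose[OF Vector_Spaces.linear_compose[OF p_linear \<alpha>] sl]
        Vector_Spaces.linear_compose[OF EB.linear_compose_add[OF Vector_Spaces.linear_compose[OF p_linear \<phi>]
            Vector_Spaces.linear_compose[OF rl \<beta>]] il]]
    by (simp add: o_def \<gamma>_def[abs_def])
  moreover have "\<gamma> (i a) = i (\<beta> a)" for a
    by (simp add: \<gamma>_def p_i ri zero[OF sl] zero[OF \<alpha>] zero[OF \<phi>])
  moreover have "p (\<gamma> e) = \<alpha> (p e)" for e
    by (simp add: \<gamma>_def additive.add[OF linear_imp_additive[OF p_linear]] ps p_i)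
  moreover have "\<gamma> (s x) = s (\<alpha> x) + i (\<phi> x)" for x
    by (simp add: \<gamma>_def ps rs zero[OF \<beta>])
  ultimately show ?thesis
    by blast
qed

end

section \<open>The criterion for inducibility\<close>

theorem theorem4p13:
  fixes A :: "('k::field, 'a::ab_group_add) ad_algebra"
    and B :: "('k, 'b::ab_group_add) ad_algebra"
    and E :: "('k, 'e::ab_group_add) ad_algebra"
    and i :: "'b \<Rightarrow> 'e" and p :: "'e \<Rightarrow> 'a" and s :: "'a \<Rightarrow> 'e"
    and l_succ r_succ l_prec r_prec :: "'a \<Rightarrow> 'b \<Rightarrow> 'b"
    and \<omega>1 \<omega>2 :: "'a \<Rightarrow> 'a \<Rightarrow> 'b"
    and \<alpha> :: "'a \<Rightarrow> 'a" and \<beta> :: "'b \<Rightarrow> 'b"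
  assumes "nonabelian_extension A B E i p"
    and "is_section A E p s"
    and "(l_succ, r_succ, l_prec, r_prec, \<omega>1, \<omega>2) = induced_cocycle A E i s"
    and "\<alpha> \<in> Aut A" and "\<beta> \<in> Aut B"
  shows "inducible E i p \<alpha> \<beta> \<longleftrightarrow>
    (\<exists>\<phi>. Vector_Spaces.linear (scal A) (scal B) \<phi> \<and>
      (\<forall>x a. \<beta> (l_succ x a) - l_succ (\<alpha> x) (\<beta> a) = \<phi> x \<succ>\<^bsub>B\<^esub> \<beta> a) \<and>
      (\<forall>x a. \<beta> (r_succ x a) - r_succ (\<alpha> x) (\<beta> a) = \<beta> a \<succ>\<^bsub>B\<^esub> \<phi> x) \<and>
      (\<forall>x a. \<beta> (l_prec x a) - l_prec (\<alpha> x) (\<beta> a) = \<phi> x \<prec>\<^bsub>B\<^esub> \<beta> a) \<and>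
      (\<forall>x a. \<beta> (r_prec x a) - r_prec (\<alpha> x) (\<beta> a) = \<beta> a \<prec>\<^bsub>B\<^esub> \<phi> x) \<and>
      (\<forall>x y. \<beta> (\<omega>1 x y) - \<omega>1 (\<alpha> x) (\<alpha> y) =
        \<phi> x \<succ>\<^bsub>B\<^esub> \<phi> y - \<phi> (x \<succ>\<^bsub>A\<^esub> y) + l_succ (\<alpha> x) (\<phi> y) + r_succ (\<alpha> y) (\<phi> x)) \<and>
      (\<forall>x y. \<beta> (\<omega>2 x y) - \<omega>2 (\<alpha> x) (\<alpha> y) =
        \<phi> x \<prec>\<^bsub>B\<^esub> \<phi> y - \<phi> (x \<prec>\<^bsub>A\<^esub> y) + l_prec (\<alpha> x) (\<phi> y) + r_prec (\<alpha> y) (\<phi> x)))"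
proof -
  interpret nonabelian_extension A B E i p by fact
  note s = assms(2)
  have cocycle: "l_succ = left_action i (succ E) s" "r_succ = right_action i (succ E) s"
    "l_prec = left_action i (prec E) s" "r_prec = right_action i (prec E) s"
    "\<omega>1 = defect i (succ A) (succ E) s" "\<omega>2 = defect i (prec A) (prec E) s"
    using assms(3) by (simp_all add: induced_cocycle_def)
  note i_cocycle = i_induced_cocycle[OF s, folded cocycle]
  have \<alpha>: "Vector_Spaces.linear (scal A) (scal A) \<alpha>"
    "\<And>x y. \<alpha> (x \<succ>\<^bsub>A\<^esub> y) = \<alpha> x \<succ>\<^bsub>A\<^esub> \<alpha> y" "\<And>x y. \<alpha> (x \<prec>\<^bsub>A\<^esub> y) = \<alpha> x \<prec>\<^bsub>A\<^esub> \<alpha> y"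
    using assms(4) by (simp_all add: Aut_def ad_hom_def)
  have \<beta>: "Vector_Spaces.linear (scal B) (scal B) \<beta>"
    "\<And>x y. \<beta> (x \<succ>\<^bsub>B\<^esub> y) = \<beta> x \<succ>\<^bsub>B\<^esub> \<beta> y" "\<And>x y. \<beta> (x \<prec>\<^bsub>B\<^esub> y) = \<beta> x \<prec>\<^bsub>B\<^esub> \<beta> y"
    using assms(5) by (simp_all add: Aut_def ad_hom_def)
  have i: "additive i"
    "\<And>x y. i (x \<succ>\<^bsub>B\<^esub> y) = i x \<succ>\<^bsub>E\<^esub> i y" "\<And>x y. i (x \<prec>\<^bsub>B\<^esub> y) = i x \<prec>\<^bsub>E\<^esub> i y"
    using hom_i by (auto simp: ad_hom_def intro: linear_imp_additive)
  have split: "\<exists>x a. e = s x + i a" for e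
    using section_split[OF s, of e] by (metis add.commute diff_add_cancel)
  let ?eqs = "\<lambda>\<phi>.
      (\<forall>x a. \<beta> (l_succ x a) - l_succ (\<alpha> x) (\<beta> a) = \<phi> x \<succ>\<^bsub>B\<^esub> \<beta> a) \<and>
      (\<forall>x a. \<beta> (r_succ x a) - r_succ (\<alpha> x) (\<beta> a) = \<beta> a \<succ>\<^bsub>B\<^esub> \<phi> x) \<and>
      (\<forall>x a. \<beta> (l_prec x a) - l_prec (\<alpha> x) (\<beta> a) = \<phi> x \<prec>\<^bsub>B\<^esub> \<beta> a) \<and>
      (\<forall>x a. \<beta> (r_prec x a) - r_prec (\<alpha> x) (\<beta> a) = \<beta> a \<prec>\<^bsub>B\<^esub> \<phi> x) \<and>
      (\<forall>x y. \<beta> (\<omega>1 x y) - \<omega>1 (\<alpha> x) (\<alpha> y) =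
        \<phi> x \<succ>\<^bsub>B\<^esub> \<phi> y - \<phi> (x \<succ>\<^bsub>A\<^esub> y) + l_succ (\<alpha> x) (\<phi> y) + r_succ (\<alpha> y) (\<phi> x)) \<and>
      (\<forall>x y. \<beta> (\<omega>2 x y) - \<omega>2 (\<alpha> x) (\<alpha> y) =
        \<phi> x \<prec>\<^bsub>B\<^esub> \<phi> y - \<phi> (x \<prec>\<^bsub>A\<^esub> y) + l_prec (\<alpha> x) (\<phi> y) + r_prec (\<alpha> y) (\<phi> x))"
  have hom_iff: "ad_hom E E \<gamma> \<longleftrightarrow> ?eqs \<phi>"
    if \<gamma>: "Vector_Spaces.linear (scal E) (scal E) \<gamma>" "\<And>a. \<gamma> (i a) = i (\<beta> a)"
      "\<And>x. \<gamma> (s x) = s (\<alpha> x) + i (\<phi> x)" for \<gamma> \<phi>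
  proof -
    note step = preserves_operation_iff[where i = i and s = s and \<alpha> = \<alpha> and \<beta> = \<beta> and
        \<gamma> = \<gamma> and \<phi> = \<phi>, OF i(1) inj_i bilinear_op_imp_biadditive
        linear_imp_additive[OF \<gamma>(1)] split _ _ _ _ _ _ \<gamma>(2,3)]
    note step_succ = step[where gA = "succ A" and gB = "succ B" and gE = "succ E" and
        L = l_succ and R = r_succ and W = \<omega>1,
        OF E.bilinear_succ i(2) i_cocycle(1,2,5) \<alpha>(2) \<beta>(2)]
    note step_prec = step[where gA = "prec A" and gB = "prec B" and gE = "prec E" and
        L = l_prec and R = r_prec and W = \<omega>2,
        OF E.bilinear_prec i(3) i_cocycle(3,4,6) \<alpha>(3) \<beta>(3)]
    show ?thesis
      unfolding ad_hom_def step_succ step_prec using \<gamma>(1) by blast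
  qed
  show ?thesis
  proof
    assume "inducible E i p \<alpha> \<beta>"
    then obtain \<gamma> where \<gamma>: "ad_hom E E \<gamma>" "\<And>a. \<gamma> (i a) = i (\<beta> a)" "\<And>e. p (\<gamma> e) = \<alpha> (p e)"
      unfolding inducible_iff_hom[OF assms(4,5)] by blast
    then have "Vector_Spaces.linear (scal E) (scal E) \<gamma>"
      by (simp add: ad_hom_def)
    with difference_of_lift[OF s \<alpha>(1) this \<gamma>(3)] hom_iff \<gamma>
    show "\<exists>\<phi>. Vector_Spaces.linear (scal A) (scal B) \<phi> \<and> ?eqs \<phi>"
      by meson
  next
    assume "\<exists>\<phi>. Vector_Spaces.linear (scal A) (scal B) \<phi> \<and> ?eqs \<phi>"
    then obtain \<phi> where \<phi>: "Vector_Spaces.linear (scal A) (scal B) \<phi>" "?eqs \<phi>"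
      by blast
    obtain \<gamma> where \<gamma>: "Vector_Spaces.linear (scal E) (scal E) \<gamma>" "\<And>a. \<gamma> (i a) = i (\<beta> a)"
      "\<And>e. p (\<gamma> e) = \<alpha> (p e)" "\<And>x. \<gamma> (s x) = s (\<alpha> x) + i (\<phi> x)"
      using lift_of_difference[OF s \<alpha>(1) \<beta>(1) \<phi>(1)] by blast
    have "ad_hom E E \<gamma>"
      using hom_iff[OF \<gamma>(1,2,4)] \<phi>(2) by (rule iffD2)
    then show "inducible E i p \<alpha> \<beta>"
      unfolding inducible_iff_hom[OF assms(4,5)] using \<gamma>(2,3) by blast
  qed
qed

end
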